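(* For any graph $G$ of order $n$: (a) $\lambda(M(G))\leq 2n$ if and only if $i_4(\overline{G})\leq 4$; (b) for every positive integer $r$, $\lambda(M(G))=2n+r$ if and only if $\lceil i_4(\overline{G})/2\rceil=r+2$.
   Context: Graphs are finite, simple, undirected; $\overline{G}$ is the complement of $G$. An $L(2,1)$-labeling of $G$ is a map $f:V\to\{0,1,2,\dots\}$ with $|f(x)-f(y)|\ge 2$ if $d_G(x,y)=1$ and $|f(x)-f(y)|\ge1$ if $d_G(x,y)=2$; $\lambda(G)$ is the minimum over such $f$ of the largest label. For $V=\{v_1,\dots,v_n\}$, $M(G)$ has vertex set $V\cup\{v_1',\dots,v_n'\}\cup\{u\}$ and edge set $E\cup\{v_iv_j' : v_iv_j\in E\}\cup\{v_i'u\}$. A 4-star matching of a graph $H$ is a subgraph each of whose components is isomorphic to $K_{1,i}$ for some $1\le i\le 4$; $s_4(H)$ is the maximum order of a 4-star matching of $H$ and $i_4(H)=|V(H)|-s_4(H)$. *)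

theory Defs
  imports
    "Graph_Theory.Graph_Theory"
    "HOL-Library.Extended_Real"
begin

text \<open>
  Finite simple undirected graphs are the \<open>pair_graph\<close>s of the Graph Theory library: finite
  loop-free symmetric digraphs without parallel arcs, so that an edge \<open>uv\<close> is the pair of arcs
  \<open>(u, v)\<close> and \<open>(v, u)\<close>.
\<close>

definition complement_graph :: "'a pair_pre_digraph \<Rightarrow> 'a pair_pre_digraph" where
  "complement_graph G =
    \<lparr> pverts = pverts G,
      parcs = {(x, y). x \<in> pverts G \<and> y \<in> pverts G \<and> x \<noteq> y \<and> (x, y) \<notin> parcs G} \<rparr>"

definition graph_dist :: "'a pair_pre_digraph \<Rightarrow> 'a \<Rightarrow> 'a \<Rightarrow> ereal" where
  "graph_dist G x y = wf_digraph.\<mu> (with_proj G) (\<lambda>_. 1) x y"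

definition L21_labeling :: "'a pair_pre_digraph \<Rightarrow> ('a \<Rightarrow> nat) \<Rightarrow> bool" where
  "L21_labeling G f \<longleftrightarrow>
    (\<forall>x \<in> pverts G. \<forall>y \<in> pverts G.
      (graph_dist G x y = 1 \<longrightarrow> \<bar>int (f x) - int (f y)\<bar> \<ge> 2) \<and>
      (graph_dist G x y = 2 \<longrightarrow> \<bar>int (f x) - int (f y)\<bar> \<ge> 1))"

definition L21_number :: "'a pair_pre_digraph \<Rightarrow> nat" where
  "L21_number G = (LEAST k. \<exists>f. L21_labeling G f \<and> Max (f ` pverts G) = k)"

datatype 'a mycielski_vertex = Orig 'a | Copy 'a | Root

definition mycielski_graph :: "'a pair_pre_digraph \<Rightarrow> 'a mycielski_vertex pair_pre_digraph" where
  "mycielski_graph G =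
    \<lparr> pverts = Orig ` pverts G \<union> Copy ` pverts G \<union> {Root},
      parcs = {(Orig x, Orig y) | x y. (x, y) \<in> parcs G}
        \<union> {(Orig x, Copy y) | x y. (x, y) \<in> parcs G}
        \<union> {(Copy y, Orig x) | x y. (x, y) \<in> parcs G}
        \<union> {(Copy x, Root) | x. x \<in> pverts G}
        \<union> {(Root, Copy x) | x. x \<in> pverts G} \<rparr>"

text \<open>
  In a symmetric digraph the strongly connected components \<open>sccs\<close> are the connected components
  of the underlying undirected graph. The requirement \<open>pair_graph S\<close> keeps a subgraph \<open>S\<close>
  symmetric.
\<close>

definition star_matching :: "nat \<Rightarrow> 'a pair_pre_digraph \<Rightarrow> 'a pair_pre_digraph \<Rightarrow> bool" where
  "star_matching k H S \<longleftrightarrow>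
    pair_graph S \<and> subgraph (with_proj S) (with_proj H) \<and>
    (\<forall>C \<in> pre_digraph.sccs (with_proj S). \<exists>i \<in> {1..k}. K\<^bsub>1,i\<^esub> C)"

definition s4 :: "'a pair_pre_digraph \<Rightarrow> nat" where
  "s4 H = Max {card (pverts S) | S. star_matching 4 H S}"

definition i4 :: "'a pair_pre_digraph \<Rightarrow> nat" where
  "i4 H = card (pverts H) - s4 H"


text \<open>Well-formedness of the constructions, and well-definedness of the extrema above.\<close>

lemma finite_arcs_complement:
  assumes "pair_graph G"
  shows "finite (parcs (complement_graph G))"
proof -
  interpret pair_graph G by fact
  show ?thesis
    by (rule finite_subset[of _ "pverts G \<times> pverts G"])
      (auto simp: complement_graph_def pair_finite_verts)
qed

lemma pair_graph_complement:
  assumes "pair_graph G"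
  shows "pair_graph (complement_graph G)"
proof -
  interpret pair_graph G by fact
  show ?thesis
    using finite_arcs_complement[OF assms] pair_finite_verts arcs_symmetric
    by unfold_locales (auto simp: complement_graph_def symmetric_def sym_def)
qed

lemma pair_graph_mycielski:
  assumes "pair_graph G"
  shows "pair_graph (mycielski_graph G)"
proof -
  interpret pair_graph G by fact
  let ?M = "mycielski_graph G"
  have "parcs ?M \<subseteq> pverts ?M \<times> pverts ?M"
    by (auto simp: mycielski_graph_def dest: in_arcsD1 in_arcsD2)
  moreover have fin: "finite (pverts ?M)"
    by (auto simp: mycielski_graph_def pair_finite_verts)
  ultimately have "finite (parcs ?M)"
    by (meson finite_SigmaI finite_subset)
  then show ?thesis
    using fin arcs_symmetric
    by unfold_locales
      (auto simp: mycielski_graph_def symmetric_def sym_def dest: in_arcsD1 in_arcsD2 no_loops')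
qed

lemma star_matching_orders:
  assumes "pair_graph H"
  shows "finite {card (pverts S) | S. star_matching k H S}"
    and "{card (pverts S) | S. star_matching k H S} \<noteq> {}"
proof -
  interpret pair_graph H by fact
  have "{card (pverts S) | S. star_matching k H S} \<subseteq> {..card (pverts H)}"
    by (auto simp: star_matching_def subgraph_def intro!: card_mono pair_finite_verts)
  then show "finite {card (pverts S) | S. star_matching k H S}"
    using finite_subset by blast
  let ?S = "\<lparr> pverts = {}, parcs = {} \<rparr> :: 'a pair_pre_digraph"
  have "pair_graph ?S"
    by unfold_locales (auto simp: symmetric_def sym_def)
  moreover have "subgraph (with_proj ?S) (with_proj H)"
    using pair_graph.pair_graphD_graph[OF \<open>pair_graph ?S\<close>]
    by (auto simp: subgraph_def compatible_def wf_digraph_wp_iff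
        intro: pair_wf_digraph pair_wf_digraph.intro)
  moreover have "pre_digraph.sccs (with_proj ?S) = {}"
    by (auto simp: pre_digraph.sccs_def induced_subgraph_def subgraph_def strongly_connected_def)
  ultimately have "star_matching k H ?S"
    by (auto simp: star_matching_def)
  then show "{card (pverts S) | S. star_matching k H S} \<noteq> {}"
    by blast
qed

lemma ex_L21_labeling:
  assumes "pair_graph G"
  shows "\<exists>f. L21_labeling G f"
proof -
  interpret pair_graph G by fact
  obtain g :: "'a \<Rightarrow> nat" where g: "inj_on g (pverts G)"
    using finite_imp_inj_to_nat_seg[OF pair_finite_verts] by blast
  have d: "graph_dist G x x = 0" if "x \<in> pverts G" for x
  proof (rule antisym)
    have "awalk x [] x"
      using that by (simp add: awalk_Nil_iff)
    from min_cost_le_walk_cost[OF this, of "\<lambda>_. 1"] show "graph_dist G x x \<le> 0"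
      by (simp add: graph_dist_def zero_ereal_def)
    show "0 \<le> graph_dist G x x"
      unfolding graph_dist_def \<mu>_def
      by (intro INF_greatest) (auto simp: awalk_cost_def intro!: sum_list_nonneg)
  qed
  have "L21_labeling G (\<lambda>x. 2 * g x)"
    unfolding L21_labeling_def
  proof (intro ballI)
    fix x y assume xy: "x \<in> pverts G" "y \<in> pverts G"
    show "(graph_dist G x y = 1 \<longrightarrow> \<bar>int (2 * g x) - int (2 * g y)\<bar> \<ge> 2) \<and>
      (graph_dist G x y = 2 \<longrightarrow> \<bar>int (2 * g x) - int (2 * g y)\<bar> \<ge> 1)"
    proof (cases "x = y")
      case True
      then show ?thesis using d xy by simp
    next
      case False
      then have "g x \<noteq> g y" using g xy by (auto dest: inj_onD)
      then show ?thesis by auto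
    qed
  qed
  then show ?thesis by blast
qed

end

theory Submission
  imports Defs
begin

text \<open>
  For every \<open>r\<close>, the Mycielski graph of \<open>G\<close> has an \<open>L(2,1)\<close>-labeling with labels at most \<open>2n + r\<close>
  iff the complement \<open>H\<close> of \<open>G\<close> has a 4-star matching missing at most \<open>2r + 4\<close> vertices.

  From a star matching, a labeling is an ordering of the vertices with gaps such that neighbours
  in the ordering are not adjacent. A star with centre \<open>x\<close> and leaves \<open>y\<^sub>1, \<dots>, y\<^sub>4\<close> gives
  \<open>y\<^sub>1' y\<^sub>1 x y\<^sub>2 y\<^sub>2' y\<^sub>3' y\<^sub>3 x' y\<^sub>4 y\<^sub>4'\<close>; two missed vertices are stored at the ends of the
  ordering, two next to the root, and the others in pairs \<open>v' v _ w w'\<close> at the expense of a gap.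

  Conversely, by Hall's theorem it suffices to bound every clique \<open>X\<close> of \<open>G\<close> by \<open>4s + 2r + 4\<close>,
  where \<open>S\<close> is the neighbourhood of \<open>X\<close> in \<open>H\<close> and \<open>s = |S|\<close>. If \<open>|X| \<ge> 2\<close>, then the vertices of
  \<open>V - S\<close>, their copies and the root have distinct labels, so at most \<open>r + 2s\<close> labels are free.
  Each of the \<open>2|X|\<close> labels next to that of a vertex \<open>x\<close> in \<open>X\<close> is out of range (at most two times),
  the label of \<open>x'\<close> (once for each \<open>x\<close>), the label of the root (at most two times), or free (each
  free label at most two times). Hence \<open>2|X| \<le> 2 + |X| + 2 + 2(r + 2s)\<close>.
\<close>

section \<open>Star forests\<close>

text \<open>Induction on \<open>I\<close>. If some nonempty proper \<open>J\<close> is tight,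
  \<open>J\<close> and \<open>I - J\<close> are matched separately, the latter avoiding all values
  available to \<open>J\<close>. Otherwise every nonempty proper subset has a spare value, so one
  index may take any of its values.\<close>

lemma hall_marriage:
  fixes F :: "'i \<Rightarrow> 'b set"
  assumes "finite I" and "\<And>i. i \<in> I \<Longrightarrow> finite (F i)"
    and "\<And>J. J \<subseteq> I \<Longrightarrow> card J \<le> card (\<Union> (F ` J))"
  shows "\<exists>h. inj_on h I \<and> (\<forall>i \<in> I. h i \<in> F i)"
  using assms
proof (induction I arbitrary: F rule: finite_psubset_induct)
  case (psubset I)
  note fin = psubset.prems(1) and hall = psubset.prems(2)
  have finU: "finite (\<Union> (F ` J))" if "J \<subseteq> I" for J
    using that fin finite_subset[OF that psubset.hyps] by auto
  show ?case
  proof (cases "\<exists>J. J \<subset> I \<and> J \<noteq> {} \<and> card (\<Union> (F ` J)) = card J")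
    case True
    then obtain J where J: "J \<subset> I" "J \<noteq> {}" "card (\<Union> (F ` J)) = card J" by blast
    obtain h1 where h1: "inj_on h1 J" "\<forall>i \<in> J. h1 i \<in> F i"
    proof -
      have "\<exists>h. inj_on h J \<and> (\<forall>i \<in> J. h i \<in> F i)"
        using J(1) by (intro psubset.IH fin hall) auto
      then show ?thesis using that by blast
    qed
    let ?F = "\<lambda>i. F i - \<Union> (F ` J)"
    have hall2: "card K \<le> card (\<Union> (?F ` K))" if K: "K \<subseteq> I - J" for K
    proof -
      have sub: "K \<union> J \<subseteq> I" using K J(1) by blast
      have "card K + card J = card (K \<union> J)"
        using K J(1) psubset.hyps by (subst card_Un_disjoint) (auto intro: finite_subset)
      also have "\<dots> \<le> card (\<Union> (F ` (K \<union> J)))" using hall[OF sub] .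
      also have "\<Union> (F ` (K \<union> J)) = \<Union> (?F ` K) \<union> \<Union> (F ` J)" by auto
      also have "card \<dots> \<le> card (\<Union> (?F ` K)) + card (\<Union> (F ` J))" by (rule card_Un_le)
      finally show ?thesis using J(3) by simp
    qed
    have "I - J \<subset> I" using J by blast
    then have "\<exists>h. inj_on h (I - J) \<and> (\<forall>i \<in> I - J. h i \<in> ?F i)"
      by (rule psubset.IH) (use fin hall2 in auto)
    then obtain h2 where h2: "inj_on h2 (I - J)" "\<forall>i \<in> I - J. h2 i \<in> ?F i" by blast
    let ?h = "\<lambda>i. if i \<in> J then h1 i else h2 i"
    have "h1 i \<noteq> h2 j" if "i \<in> J" "j \<in> I - J" for i j
      using that h1(2) h2(2) by fastforce
    then have "inj_on ?h I"
      using h1(1) h2(1) J(1) unfolding inj_on_def by (metis DiffI)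
    moreover have "\<forall>i \<in> I. ?h i \<in> F i" using h1 h2 by auto
    ultimately show ?thesis by blast
  next
    case False
    show ?thesis
    proof (cases "I = {}")
      case False
      then obtain i where i: "i \<in> I" by blast
      have "F i \<noteq> {}" using hall[of "{i}"] i by auto
      then obtain x where x: "x \<in> F i" by blast
      let ?F = "\<lambda>j. F j - {x}"
      have hall2: "card K \<le> card (\<Union> (?F ` K))" if K: "K \<subseteq> I - {i}" for K
      proof (cases "K = {}")
        case False
        have KI: "K \<subset> I" using K i by blast
        then have "card K < card (\<Union> (F ` K))"
          using \<open>\<not> (\<exists>J. _ J)\<close> False hall[of K] by (metis psubset_imp_subset le_neq_implies_less)
        moreover have "\<Union> (?F ` K) = \<Union> (F ` K) - {x}" by auto
        ultimately show ?thesis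
          using finU[of K] KI by (auto simp: card_Diff_singleton_if)
      qed simp
      have "I - {i} \<subset> I" using i by blast
      then have "\<exists>h. inj_on h (I - {i}) \<and> (\<forall>j \<in> I - {i}. h j \<in> ?F j)"
        by (rule psubset.IH) (use fin hall2 in auto)
      then obtain h where h: "inj_on h (I - {i})" "\<forall>j \<in> I - {i}. h j \<in> ?F j" by blast
      have "inj_on (h(i := x)) I"
        using h unfolding inj_on_def by (metis DiffD2 DiffI fun_upd_apply singletonD singletonI)
      moreover have "\<forall>j \<in> I. (h(i := x)) j \<in> F j" using h x by auto
      ultimately show ?thesis by blast
    qed simp
  qed
qed

text \<open>
  A forest of stars with at most \<open>k\<close> leaves each is given by its set \<open>L\<close> of leaves and the map \<open>g\<close>
  from leaves to centres; of the two ends of a star \<open>K\<^sub>1\<^sub>,\<^sub>1\<close> one is declared to be the leaf.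
\<close>

definition star_forest :: "nat \<Rightarrow> 'a rel \<Rightarrow> 'a set \<Rightarrow> ('a \<Rightarrow> 'a) \<Rightarrow> bool" where
  "star_forest k E L g \<longleftrightarrow> finite L \<and> g ` L \<inter> L = {} \<and> (\<forall>v \<in> L. (v, g v) \<in> E) \<and>
    (\<forall>w. card {v \<in> L. g v = w} \<le> k)"

lemma star_forest_mono: "star_forest k E L g \<Longrightarrow> E \<subseteq> E' \<Longrightarrow> star_forest k E' L g"
  by (auto simp: star_forest_def)

text \<open>Both orientations are included because the stars built below may point against
  \<open>f\<close>: a vertex can become the leaf of one of its preimages.\<close>

definition function_edges :: "('a \<Rightarrow> 'a) \<Rightarrow> 'a set \<Rightarrow> 'a rel" where
  "function_edges f A = {(v, w). v \<in> A \<and> f v = w \<or> w \<in> A \<and> f w = v}"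

text \<open>If \<open>p\<close> is not a leaf, \<open>q\<close> can be hung on \<open>p\<close>. If
  \<open>p\<close> is a leaf, it is detached from its centre \<open>x\<close> and becomes the centre
  of a new star with leaf \<open>q\<close>; should \<open>x\<close> thereby lose its only leaf,
  \<open>x\<close> becomes a second leaf of \<open>p\<close>, whence \<open>2 \<le> k\<close>.
  Covered vertices stay covered in every case.\<close>

lemma star_forest_extend:
  assumes sf: "star_forest k (function_edges f A') L g"
    and "finite A'" "A' \<subseteq> A" "p \<notin> A'" "p \<noteq> q" "q \<notin> L \<union> g ` L" "2 \<le> k"
    and qp: "(q, p) \<in> function_edges f A"
    and fibre: "card (insert q {v \<in> A'. f v = p}) \<le> k"
  shows "\<exists>L' g'. star_forest k (function_edges f A) L' g' \<and> L \<union> g ` L \<union> {p, q} \<subseteq> L' \<union> g' ` L'"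
proof -
  let ?E = "function_edges f A"
  have finL: "finite L" and disj: "g ` L \<inter> L = {}"
    and edges: "\<And>v. v \<in> L \<Longrightarrow> (v, g v) \<in> function_edges f A'"
    and cap: "\<And>w. card {v \<in> L. g v = w} \<le> k"
    using sf by (auto simp: star_forest_def)
  have edges': "\<And>v. v \<in> L \<Longrightarrow> (v, g v) \<in> ?E"
    using edges \<open>A' \<subseteq> A\<close> by (fastforce simp: function_edges_def)
  show ?thesis
  proof (cases "p \<in> L")
    case False
    let ?L = "insert q L" and ?g = "g(q := p)"
    have "card {v \<in> ?L. ?g v = w} \<le> k" for w
    proof (cases "w = p")
      case True
      \<comment> \<open>As \<open>p\<close> is not in \<open>A'\<close>, an edge of the old forest
        from a leaf to \<open>p\<close> can only come from \<open>f\<close>, so the old leaves of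
        \<open>p\<close> lie in the fibre of \<open>p\<close>.\<close>
      have "{v \<in> ?L. ?g v = w} \<subseteq> insert q {v \<in> A'. f v = p}"
        using True edges \<open>p \<notin> A'\<close> by (fastforce simp: function_edges_def split: if_splits)
      from card_mono[OF _ this] show ?thesis
        using fibre \<open>finite A'\<close> by simp
    next
      case False
      have "{v \<in> ?L. ?g v = w} = {v \<in> L. g v = w}"
        using False assms(6) by auto
      then show ?thesis using cap by simp
    qed
    then have "star_forest k ?E ?L ?g"
      using finL disj edges' qp assms False by (auto simp: star_forest_def)
    moreover have "L \<union> g ` L \<union> {p, q} \<subseteq> ?L \<union> ?g ` ?L"
      using assms(6) by auto
    ultimately show ?thesis by blast
  next
    case True
    define x where "x = g p"
    have x: "x \<in> A'" "f x = p"
      using edges[OF True] \<open>p \<notin> A'\<close> by (auto simp: function_edges_def x_def)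
    have x': "x \<notin> L" "x \<noteq> q" "x \<noteq> p" "p \<notin> g ` L" using disj True assms(6) x \<open>p \<notin> A'\<close> by (auto simp: x_def)
    have xp: "(x, p) \<in> ?E" using x \<open>A' \<subseteq> A\<close> by (auto simp: function_edges_def)
    show ?thesis
    proof (cases "\<exists>v \<in> L. v \<noteq> p \<and> g v = x")
      case other: True
      let ?L = "insert q (L - {p})" and ?g = "g(q := p)"
      have "card {v \<in> ?L. ?g v = w} \<le> k" for w
      proof (cases "w = p")
        case True
        have "{v \<in> ?L. ?g v = w} \<subseteq> {q}" using True x' by auto
        then show ?thesis using \<open>2 \<le> k\<close> card_mono[of "{q}" "{v \<in> ?L. ?g v = w}"] by simp
      next
        case False
        have "{v \<in> ?L. ?g v = w} \<subseteq> {v \<in> L. g v = w}" using False by auto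
        then show ?thesis using cap[of w] finL card_mono[of "{v \<in> L. g v = w}" "{v \<in> ?L. ?g v = w}"] by simp
      qed
      then have "star_forest k ?E ?L ?g"
        using finL disj edges' qp assms by (auto simp: star_forest_def)
      moreover have "L \<union> g ` L \<union> {p, q} \<subseteq> ?L \<union> ?g ` ?L"
      proof -
        have "g ` L \<subseteq> ?g ` ?L"
        proof
          fix y assume "y \<in> g ` L"
          then obtain v where v: "v \<in> L" "v \<noteq> p" "y = g v"
            using other x_def by (metis imageE)
          then have "v \<noteq> q" using assms(6) by auto
          then show "y \<in> ?g ` ?L" using v by (auto simp: image_iff)
        qed
        then show ?thesis by auto
      qed
      ultimately show ?thesis by blast
    next
      case none: False
      let ?L = "insert q (insert x (L - {p}))" and ?g = "g(q := p, x := p)"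
      have "card {v \<in> ?L. ?g v = w} \<le> k" for w
      proof (cases "w = p")
        case True
        have "{v \<in> ?L. ?g v = w} \<subseteq> {q, x}" using True x' by auto
        then show ?thesis
          using \<open>2 \<le> k\<close> card_mono[of "{q, x}" "{v \<in> ?L. ?g v = w}"] x' by (simp add: card_insert_if split: if_splits)
      next
        case False
        have "{v \<in> ?L. ?g v = w} \<subseteq> {v \<in> L. g v = w}" using False by auto
        then show ?thesis using cap[of w] finL card_mono[of "{v \<in> L. g v = w}" "{v \<in> ?L. ?g v = w}"] by simp
      qed
      moreover have "?g ` ?L \<inter> ?L = {}"
        using disj none x' assms(5,6) by auto
      moreover have "\<forall>v \<in> ?L. (v, ?g v) \<in> ?E" using edges' xp qp by auto
      ultimately have "star_forest k ?E ?L ?g"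
        using finL by (simp add: star_forest_def)
      moreover have "L \<union> g ` L \<union> {p, q} \<subseteq> ?L \<union> ?g ` ?L"
      proof -
        have "g ` L \<subseteq> ?L \<union> ?g ` ?L"
        proof
          fix y assume "y \<in> g ` L"
          then obtain v where v: "v \<in> L" "y = g v" by blast
          show "y \<in> ?L \<union> ?g ` ?L"
          proof (cases "v = p")
            case False
            then have "v \<noteq> q" "v \<noteq> x" using assms(6) v x' by auto
            then show ?thesis using v False by (auto simp: image_iff)
          qed (use v x_def in auto)
        qed
        then show ?thesis by auto
      qed
      ultimately show ?thesis by blast
    qed
  qed
qed

lemma star_forest_verts_function_edges:
  assumes "star_forest k (function_edges f A) L g"
  shows "L \<union> g ` L \<subseteq> A \<union> f ` A"
proof -
  have "v \<in> A \<union> f ` A \<and> g v \<in> A \<union> f ` A" if "v \<in> L" for v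
  proof -
    have "(v, g v) \<in> function_edges f A" using assms that by (simp add: star_forest_def)
    then show ?thesis by (auto simp: function_edges_def intro: rev_image_eqI)
  qed
  then show ?thesis by blast
qed

text \<open>
  By induction: solve the problem without the edge between \<open>a\<close> and \<open>f a\<close> and extend the solution
  by that edge. Here \<open>a\<close> is chosen outside the image of \<open>f\<close> if possible; otherwise \<open>f\<close> permutes
  \<open>A\<close>, and any \<open>a\<close> will do.
\<close>

lemma star_forest_of_function:
  assumes "finite A" "2 \<le> k" "\<And>v. v \<in> A \<Longrightarrow> f v \<noteq> v" "\<And>w. card {v \<in> A. f v = w} \<le> k"
  shows "\<exists>L g. star_forest k (function_edges f A) L g \<and> A \<subseteq> L \<union> g ` L"
  using assms
proof (induction A rule: finite_psubset_induct)
  case (psubset A)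
  note fin = psubset.hyps and k = psubset.prems(1) and irr = psubset.prems(2) and cap = psubset.prems(3)
  have IH: "\<exists>L g. star_forest k (function_edges f A') L g \<and> A' \<subseteq> L \<union> g ` L" if "A' \<subset> A" for A'
  proof (rule psubset.IH[OF that k])
    show "f v \<noteq> v" if "v \<in> A'" for v using that \<open>A' \<subset> A\<close> irr by blast
    show "card {v \<in> A'. f v = w} \<le> k" for w
    proof -
      have "card {v \<in> A'. f v = w} \<le> card {v \<in> A. f v = w}"
        using fin that by (intro card_mono) auto
      then show ?thesis using cap[of w] by linarith
    qed
  qed
  show ?case
  proof (cases "A = {}")
    case True
    have "star_forest k (function_edges f A) {} f" by (simp add: star_forest_def)
    then show ?thesis using True by blast
  next
    case nonempty: False
    \<comment> \<open>\<open>p\<close> is to carry the new leaf \<open>q\<close>. Since no remaining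
      vertex is mapped to \<open>q\<close>, the forest obtained for \<open>A - {p, q}\<close> does
      not cover \<open>q\<close>, as the extension lemma demands.\<close>
    have step: ?thesis
      if pq: "p \<noteq> q" "(q, p) \<in> function_edges f A" "p \<in> A \<or> q \<in> A" "q \<notin> f ` (A - {p, q})"
        and fibre: "card (insert q {v \<in> A - {p, q}. f v = p}) \<le> k" for p q
    proof -
      let ?A = "A - {p, q}"
      have "?A \<subset> A" using pq(3) by blast
      then obtain L g where Lg: "star_forest k (function_edges f ?A) L g" "?A \<subseteq> L \<union> g ` L"
        using IH by blast
      have "q \<notin> L \<union> g ` L"
        using star_forest_verts_function_edges[OF Lg(1)] pq(4) by blast
      then obtain L' g' where L': "star_forest k (function_edges f A) L' g'"
          "L \<union> g ` L \<union> {p, q} \<subseteq> L' \<union> g' ` L'"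
        using star_forest_extend[OF Lg(1) _ _ _ pq(1) _ k pq(2) fibre] fin
        by (metis Diff_iff Diff_subset finite_Diff insertI1)
      moreover have "A \<subseteq> L \<union> g ` L \<union> {p, q}" using Lg(2) by blast
      ultimately have "A \<subseteq> L' \<union> g' ` L'" by (meson subset_trans)
      with L' show ?thesis by (intro exI conjI)
    qed
    show ?thesis
    proof (cases "A \<subseteq> f ` A")
      case False
      then obtain a where a: "a \<in> A" "a \<notin> f ` A" by blast
      show ?thesis
      proof (rule step[of "f a" a])
        have "insert a {v \<in> A - {f a, a}. f v = f a} \<subseteq> {v \<in> A. f v = f a}" using a by auto
        from card_mono[OF _ this] show "card (insert a {v \<in> A - {f a, a}. f v = f a}) \<le> k"
          using cap[of "f a"] fin by simp
      qed (use a irr in \<open>auto simp: function_edges_def\<close>)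
    next
      case True
      then have surj: "f ` A = A"
        using card_seteq[OF finite_imageI[OF fin] True card_image_le[OF fin]] by simp
      then have inj: "inj_on f A" using eq_card_imp_inj_on[OF fin, of f] by simp
      obtain a where a: "a \<in> A" using nonempty by blast
      show ?thesis
      \<comment> \<open>Here \<open>f a\<close> is the leaf and \<open>a\<close> the centre: by
        injectivity \<open>f a\<close> has no preimage other than \<open>a\<close>, and
        \<open>a\<close> has a single preimage, so at most two leaves have to be counted.\<close>
      proof (rule step[of a "f a"])
        have "a \<in> f ` A" using a surj by simp
        then obtain p where "p \<in> A" "f p = a" by auto
        then have "insert (f a) {v \<in> A - {a, f a}. f v = a} \<subseteq> {f a, p}"
          using inj by (auto dest: inj_onD)
        then have "card (insert (f a) {v \<in> A - {a, f a}. f v = a}) \<le> card {f a, p}"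
          by (intro card_mono) auto
        also have "\<dots> \<le> k" using k by (simp add: card_insert_if)
        finally show "card (insert (f a) {v \<in> A - {a, f a}. f v = a}) \<le> k" .
        show "a \<noteq> f a" using irr[OF a] by simp
        show "f a \<notin> f ` (A - {a, f a})" using inj a by (auto dest: inj_onD)
      qed (use a irr in \<open>auto simp: function_edges_def\<close>)
    qed
  qed
qed

text \<open>
  The deficiency version of Hall's theorem with capacity \<open>k\<close> on the centres. The Hall condition for
  an arbitrary \<open>X\<close> follows from that for independent sets, because the vertices of \<open>X\<close> that have a
  neighbour in \<open>X\<close> themselves belong to the neighbourhood of \<open>X\<close>.
\<close>

lemma star_forest_deficiency:
  assumes "finite V" "E \<subseteq> V \<times> V" "sym E" "irrefl E" "2 \<le> k"
    and indep: "\<And>X. X \<subseteq> V \<Longrightarrow> X \<inter> E `` X = {} \<Longrightarrow> card X \<le> k * card (E `` X) + d"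
  shows "\<exists>L g. star_forest k E L g \<and> card (V - (L \<union> g ` L)) \<le> d"
proof -
  have finE: "finite (E `` X)" for X
    using assms(1,2) by (intro finite_subset[OF _ \<open>finite V\<close>]) blast
  have hall: "card X \<le> k * card (E `` X) + d" if X: "X \<subseteq> V" for X
  proof -
    let ?X = "X - E `` X" and ?Y = "X \<inter> E `` X"
    have finX: "finite X" using X assms(1) finite_subset by blast
    have "card X = card ?X + card ?Y"
      using card_Diff_subset_Int[of X "E `` X"] card_mono[OF finX, of ?Y] finX by simp
    also have "card ?X \<le> k * card (E `` ?X) + d"
      using X by (intro indep) auto
    also have "card ?Y \<le> k * card ?Y" using \<open>2 \<le> k\<close> by simp
    also have "k * card (E `` ?X) + d + k * card ?Y = k * card (E `` ?X \<union> ?Y) + d"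
    proof -
      \<comment> \<open>A vertex of \<open>?Y\<close> adjacent to one of \<open>?X\<close> would put
        the latter into the neighbourhood of \<open>X\<close>.\<close>
      have "E `` ?X \<inter> ?Y = {}" using \<open>sym E\<close> by (auto dest: symD)
      then show ?thesis using finX finE by (subst card_Un_disjoint) (auto simp: algebra_simps)
    qed
    also have "\<dots> \<le> k * card (E `` X) + d"
      using finE by (intro add_mono mult_le_mono card_mono) auto
    finally show ?thesis by simp
  qed
  \<comment> \<open>Each neighbour is offered \<open>k\<close> times, and \<open>d\<close> dummy
    values are added: a vertex matched to a dummy may remain uncovered. The set \<open>A\<close>
    below consists of the vertices matched to a real neighbour.\<close>
  define F :: "'a \<Rightarrow> ('a \<times> nat + nat) set" where "F v = (E `` {v} \<times> {..<k}) <+> {..<d}" for v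
  have "\<exists>h. inj_on h V \<and> (\<forall>v \<in> V. h v \<in> F v)"
  proof (rule hall_marriage[OF \<open>finite V\<close>])
    show "finite (F v)" for v using finE by (simp add: F_def)
    show "card X \<le> card (\<Union> (F ` X))" if X: "X \<subseteq> V" for X
    proof (cases "X = {}")
      case False
      then have "\<Union> (F ` X) = (E `` X \<times> {..<k}) <+> {..<d}"
        by (auto simp: F_def Plus_def)
      then have "card (\<Union> (F ` X)) = k * card (E `` X) + d"
        using finE by (simp add: card_Plus card_cartesian_product)
      then show ?thesis using hall[OF X] by simp
    qed simp
  qed
  then obtain h where h: "inj_on h V" "\<And>v. v \<in> V \<Longrightarrow> h v \<in> F v" by blast
  define A where "A = {v \<in> V. isl (h v)}"
  define f where "f v = fst (projl (h v))" for v
  have finA: "finite A" using assms(1) by (simp add: A_def)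
  have fE: "(v, f v) \<in> E" if "v \<in> A" for v
    using that h(2)[of v] by (auto simp: A_def F_def f_def)
  have "card {v \<in> A. f v = w} \<le> k" for w
  proof -
    have "h ` {v \<in> A. f v = w} \<subseteq> (\<lambda>i. Inl (w, i)) ` {..<k}"
      using h(2) by (fastforce simp: A_def F_def f_def)
    from surj_card_le[OF _ this] have "card (h ` {v \<in> A. f v = w}) \<le> card {..<k}"
      by simp
    moreover have "inj_on h {v \<in> A. f v = w}"
      using h(1) by (rule inj_on_subset) (auto simp: A_def)
    ultimately show ?thesis by (simp add: card_image)
  qed
  moreover have "f v \<noteq> v" if "v \<in> A" for v
    using fE[OF that] \<open>irrefl E\<close> by (auto simp: irrefl_def)
  ultimately obtain L g where Lg: "star_forest k (function_edges f A) L g" "A \<subseteq> L \<union> g ` L"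
    using star_forest_of_function[OF finA \<open>2 \<le> k\<close>, of f] by blast
  have "function_edges f A \<subseteq> E"
    using fE \<open>sym E\<close> by (auto simp: function_edges_def dest: symD)
  then have "star_forest k E L g" using Lg(1) star_forest_mono by blast
  moreover have "card (V - (L \<union> g ` L)) \<le> d"
  proof -
    have "card (V - (L \<union> g ` L)) \<le> card (V - A)"
      using assms(1) Lg(2) by (intro card_mono) auto
    also have "\<dots> = card (h ` (V - A))"
      using h(1) by (metis Diff_subset card_image inj_on_subset)
    also have "\<dots> \<le> card {..<d}"
    proof -
      have "h ` (V - A) \<subseteq> Inr ` {..<d}"
        using h(2) by (fastforce simp: A_def F_def)
      from surj_card_le[OF _ this] show ?thesis by simp
    qed
    finally show ?thesis by simp
  qed
  ultimately show ?thesis by blast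
qed

section \<open>Distances and labelings\<close>

lemma (in wf_digraph) awalk_cost_const_one: "awalk_cost (\<lambda>_. 1) p = real (length p)"
  by (simp add: awalk_cost_def sum_list_triv)

lemma graph_dist_le:
  assumes "pair_graph G" "pre_digraph.awalk (with_proj G) x p y"
  shows "graph_dist G x y \<le> ereal (length p)"
proof -
  interpret pair_graph G by fact
  show ?thesis
    using min_cost_le_walk_cost[OF assms(2), of "\<lambda>_. 1"]
    by (simp add: graph_dist_def awalk_cost_const_one)
qed

lemma graph_dist_ge:
  assumes "pair_graph G" "\<And>p. pre_digraph.awalk (with_proj G) x p y \<Longrightarrow> k \<le> length p"
  shows "ereal k \<le> graph_dist G x y"
proof -
  interpret pair_graph G by fact
  show ?thesis
    unfolding graph_dist_def \<mu>_def
    by (rule INF_greatest) (use assms(2) in \<open>simp add: awalk_cost_const_one\<close>)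
qed

lemma graph_dist_self:
  assumes "pair_graph G" "x \<in> pverts G"
  shows "graph_dist G x x = 0"
proof (rule antisym)
  interpret pair_graph G by fact
  show "graph_dist G x x \<le> 0"
    using graph_dist_le[OF assms(1), of x "[]" x] assms(2)
    by (simp add: awalk_Nil_iff zero_ereal_def)
  show "0 \<le> graph_dist G x x"
    using graph_dist_ge[OF assms(1), of x x 0] by (simp add: zero_ereal_def)
qed

lemma graph_dist_arc:
  assumes "pair_graph G" "(x, y) \<in> parcs G"
  shows "graph_dist G x y = 1"
proof (rule antisym)
  interpret pair_graph G by fact
  have "awalk x [(x, y)] y"
    using assms(2) by (auto simp: awalk_simps dest: in_arcsD1 in_arcsD2)
  from graph_dist_le[OF assms(1) this] show "graph_dist G x y \<le> 1"
    by (simp add: one_ereal_def)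
  have "1 \<le> length p" if "awalk x p y" for p
    using that no_loops'[OF assms(2)] by (cases p) (auto simp: awalk_Nil_iff)
  from graph_dist_ge[OF assms(1) this] show "1 \<le> graph_dist G x y"
    by (simp add: one_ereal_def)
qed

lemma graph_dist_nonadjacent_ge:
  assumes "pair_graph G" "x \<noteq> y" "(x, y) \<notin> parcs G"
  shows "2 \<le> graph_dist G x y"
proof -
  interpret pair_graph G by fact
  have "2 \<le> length p" if "awalk x p y" for p
  proof (cases p)
    case Nil
    then show ?thesis using that assms(2) by (simp add: awalk_Nil_iff)
  next
    case (Cons e q)
    then show ?thesis using that assms(3) by (cases q) (auto simp: awalk_simps)
  qed
  from graph_dist_ge[OF assms(1) this] show ?thesis by simp
qed

lemma graph_dist_common_neighbour:
  assumes "pair_graph G" "x \<noteq> y" "(x, y) \<notin> parcs G" "(x, z) \<in> parcs G" "(z, y) \<in> parcs G"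
  shows "graph_dist G x y = 2"
proof (rule antisym)
  interpret pair_graph G by fact
  have "awalk x [(x, z), (z, y)] y"
    using assms(4,5) by (auto simp: awalk_simps dest: in_arcsD1 in_arcsD2)
  from graph_dist_le[OF assms(1) this] show "graph_dist G x y \<le> 2" by simp
  show "2 \<le> graph_dist G x y" by (rule graph_dist_nonadjacent_ge[OF assms(1-3)])
qed

lemma L21_labeling_arcD:
  assumes "pair_graph G" "L21_labeling G f" "(x, y) \<in> parcs G"
  shows "\<bar>int (f x) - int (f y)\<bar> \<ge> 2"
proof -
  interpret pair_graph G by fact
  show ?thesis
    using assms(2) graph_dist_arc[OF assms(1,3)] in_arcsD1[OF assms(3)] in_arcsD2[OF assms(3)]
    by (simp add: L21_labeling_def)
qed

text \<open>\<open>x\<close> and \<open>y\<close> may be adjacent as well, in which case the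
  stronger condition at distance one applies; so distances need not be computed when this is
  used.\<close>

lemma L21_labeling_common_neighbourD:
  assumes "pair_graph G" "L21_labeling G f" "x \<noteq> y" "(x, z) \<in> parcs G" "(z, y) \<in> parcs G"
  shows "f x \<noteq> f y"
proof (cases "(x, y) \<in> parcs G")
  case True
  then show ?thesis using L21_labeling_arcD[OF assms(1,2) True] by auto
next
  case False
  interpret pair_graph G by fact
  have "x \<in> pverts G" "y \<in> pverts G" using assms(4,5) by (auto dest: in_arcsD1 in_arcsD2)
  then have "\<bar>int (f x) - int (f y)\<bar> \<ge> 1"
    using assms(2) graph_dist_common_neighbour[OF assms(1,3) False assms(4,5)]
    unfolding L21_labeling_def by blast
  then show ?thesis by auto
qed

text \<open>Injectivity settles distance two. The labelings constructed below are all injective, so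
  only adjacency matters for them.\<close>

lemma L21_labelingI:
  assumes "pair_graph G" "inj_on f (pverts G)"
    and "\<And>x y. (x, y) \<in> parcs G \<Longrightarrow> \<bar>int (f x) - int (f y)\<bar> \<ge> 2"
  shows "L21_labeling G f"
  unfolding L21_labeling_def
proof (intro ballI conjI impI)
  fix x y assume xy: "x \<in> pverts G" "y \<in> pverts G"
  {
    assume "graph_dist G x y = 1"
    then have "(x, y) \<in> parcs G"
      using graph_dist_nonadjacent_ge[OF assms(1), of x y] graph_dist_self[OF assms(1) xy(1)]
      by (cases "x = y") auto
    then show "\<bar>int (f x) - int (f y)\<bar> \<ge> 2" by (rule assms(3))
  }
  assume "graph_dist G x y = 2"
  then have "x \<noteq> y" using graph_dist_self[OF assms(1) xy(1)] by auto
  then have "f x \<noteq> f y" using assms(2) xy by (simp add: inj_on_eq_iff)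
  then show "\<bar>int (f x) - int (f y)\<bar> \<ge> 1" by linarith
qed

lemma L21_number_le_iff:
  assumes "pair_graph G" "pverts G \<noteq> {}"
  shows "L21_number G \<le> k \<longleftrightarrow> (\<exists>f. L21_labeling G f \<and> (\<forall>x \<in> pverts G. f x \<le> k))"
proof -
  interpret pair_graph G by fact
  let ?P = "\<lambda>k. \<exists>f. L21_labeling G f \<and> Max (f ` pverts G) = k"
  have Max: "Max (f ` pverts G) \<le> k \<longleftrightarrow> (\<forall>x \<in> pverts G. f x \<le> k)" for f :: "'a \<Rightarrow> nat"
    using assms(2) by (simp add: pair_finite_verts)
  show ?thesis
  proof
    assume le: "L21_number G \<le> k"
    have "\<exists>k. ?P k" using ex_L21_labeling[OF assms(1)] by blast
    then have "?P (L21_number G)" unfolding L21_number_def by (rule LeastI_ex)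
    then obtain f where f: "L21_labeling G f" "Max (f ` pverts G) = L21_number G" by blast
    then have "\<forall>x \<in> pverts G. f x \<le> k" using le Max[of f] by simp
    with f(1) show "\<exists>f. L21_labeling G f \<and> (\<forall>x \<in> pverts G. f x \<le> k)" by blast
  next
    assume "\<exists>f. L21_labeling G f \<and> (\<forall>x \<in> pverts G. f x \<le> k)"
    then obtain f where f: "L21_labeling G f" "Max (f ` pverts G) \<le> k" using Max by blast
    then have "L21_number G \<le> Max (f ` pverts G)"
      unfolding L21_number_def by (intro Least_le) blast
    then show "L21_number G \<le> k" using f(2) by simp
  qed
qed

section \<open>Labelings of the Mycielski graph bound the cliques of the graph\<close>

lemma verts_mycielski [simp]:
  "Orig x \<in> pverts (mycielski_graph G) \<longleftrightarrow> x \<in> pverts G"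
  "Copy x \<in> pverts (mycielski_graph G) \<longleftrightarrow> x \<in> pverts G"
  "Root \<in> pverts (mycielski_graph G)"
  by (auto simp: mycielski_graph_def)

lemma arcs_mycielski [simp]:
  "(Orig x, Orig y) \<in> parcs (mycielski_graph G) \<longleftrightarrow> (x, y) \<in> parcs G"
  "(Orig x, Copy y) \<in> parcs (mycielski_graph G) \<longleftrightarrow> (x, y) \<in> parcs G"
  "(Copy x, Orig y) \<in> parcs (mycielski_graph G) \<longleftrightarrow> (y, x) \<in> parcs G"
  "(Copy x, Root) \<in> parcs (mycielski_graph G) \<longleftrightarrow> x \<in> pverts G"
  "(Root, Copy x) \<in> parcs (mycielski_graph G) \<longleftrightarrow> x \<in> pverts G"
  "(Copy x, Copy y) \<notin> parcs (mycielski_graph G)"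
  "(Orig x, Root) \<notin> parcs (mycielski_graph G)"
  "(Root, Orig x) \<notin> parcs (mycielski_graph G)"
  "(Root, Root) \<notin> parcs (mycielski_graph G)"
  by (auto simp: mycielski_graph_def)

text \<open>Independence in the complement makes \<open>X\<close> a clique of \<open>G\<close> whose
  vertices are adjacent in \<open>G\<close> to all other vertices outside \<open>S\<close>. The
  labels directly above and those directly below the labels of \<open>X\<close> are estimated
  separately and the two estimates added. For \<open>card X \<le> 1\<close> the bound is
  trivial.\<close>

lemma mycielski_labeling_bound:
  fixes G :: "'a pair_pre_digraph"
  assumes G: "pair_graph G"
    and f: "L21_labeling (mycielski_graph G) f"
    and le: "\<forall>x \<in> pverts (mycielski_graph G). f x \<le> 2 * card (pverts G) + r"
    and X: "X \<subseteq> pverts G"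
    and indep: "X \<inter> parcs (complement_graph G) `` X = {}"
  shows "card X \<le> 4 * card (parcs (complement_graph G) `` X) + (2 * r + 4)"
proof (cases "card X \<le> 1")
  case False
  interpret pair_graph G by fact
  note M = pair_graph_mycielski[OF G]
  let ?V = "pverts G" and ?K = "2 * card (pverts G) + r"
  define S where "S = parcs (complement_graph G) `` X"
  define W where "W = ?V - S"
  have finX: "finite X" using X pair_finite_verts finite_subset by blast
  have SV: "S \<subseteq> ?V" by (auto simp: S_def complement_graph_def)
  have XW: "X \<subseteq> W" using X indep by (auto simp: W_def S_def)
  have adj: "(x, w) \<in> parcs G" if "x \<in> X" "w \<in> W" "x \<noteq> w" for x w
    using that X by (auto simp: W_def S_def complement_graph_def)
  have adj': "(w, x) \<in> parcs G" if "x \<in> X" "w \<in> W" "x \<noteq> w" for x w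
    using adj[OF that] by (rule arcs_symmetric)
  have WV: "W \<subseteq> ?V" by (auto simp: W_def)
  \<comment> \<open>With two elements in \<open>X\<close>, every vertex of \<open>W\<close> has a
    neighbour in \<open>X\<close>; this is what forces the labels over \<open>W\<close> to be
    pairwise distinct.\<close>
  have other: "\<exists>x \<in> X. x \<noteq> w" for w
    using False by (metis card_le_Suc0_iff_eq finX One_nat_def)
  let ?a = "\<lambda>v. f (Orig v)" and ?b = "\<lambda>v. f (Copy v)"
  note far = L21_labeling_arcD[OF M f] and differ = L21_labeling_common_neighbourD[OF M f]
  have nbr: "\<exists>x. (v, x) \<in> parcs G \<and> (x, v) \<in> parcs G" if "v \<in> W" for v
    using other[of v] adj adj' that by blast
  have joined: "(v, w) \<in> parcs G \<or> (\<exists>x. (v, x) \<in> parcs G \<and> (x, w) \<in> parcs G)"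
    if vw: "v \<in> W" "w \<in> W" "v \<noteq> w" for v w
  proof (cases "v \<in> X \<or> w \<in> X")
    case True
    then show ?thesis using adj adj' vw by blast
  next
    case False
    obtain x where "x \<in> X" using other by blast
    then show ?thesis using adj[of x w] adj'[of x v] vw False by blast
  qed
  have aa: "?a v \<noteq> ?a w" if vw: "v \<in> W" "w \<in> W" "v \<noteq> w" for v w
    using joined[OF vw]
  proof (elim disjE exE conjE)
    assume "(v, w) \<in> parcs G"
    then show ?thesis using far[of "Orig v" "Orig w"] by auto
  next
    fix x assume "(v, x) \<in> parcs G" "(x, w) \<in> parcs G"
    then show ?thesis using differ[of "Orig v" "Orig w" "Orig x"] vw by simp
  qed
  \<comment> \<open>The case \<open>v = w\<close> is included: a vertex and its copy share the
    neighbours of the vertex.\<close>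
  have ab: "?a v \<noteq> ?b w" if vw: "v \<in> W" "w \<in> W" for v w
  proof -
    have "(v, w) \<in> parcs G \<or> (\<exists>x. (v, x) \<in> parcs G \<and> (x, w) \<in> parcs G)"
      using joined[OF vw] nbr vw by blast
    then show ?thesis
    proof (elim disjE exE conjE)
      assume "(v, w) \<in> parcs G"
      then show ?thesis using far[of "Orig v" "Copy w"] by auto
    next
      fix x assume "(v, x) \<in> parcs G" "(x, w) \<in> parcs G"
      then show ?thesis using differ[of "Orig v" "Copy w" "Orig x"] by simp
    qed
  qed
  have bb: "?b v \<noteq> ?b w" if "v \<in> W" "w \<in> W" "v \<noteq> w" for v w
    using differ[of "Copy v" "Copy w" Root] that WV by auto
  have ar: "?a v \<noteq> f Root" if v: "v \<in> W" for v
  proof -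
    obtain x where "(v, x) \<in> parcs G" using nbr[OF v] by blast
    then show ?thesis
      using differ[of "Orig v" Root "Copy x"] in_arcsD2[of v x] by simp
  qed
  have br: "?b v \<noteq> f Root" if "v \<in> W" for v
    using far[of "Copy v" Root] that WV by auto
  define T where "T = Orig ` W \<union> Copy ` W \<union> {Root}"
  have finW: "finite W" using WV pair_finite_verts finite_subset by blast
  have "inj_on f T"
  proof (rule inj_onI)
    fix s t assume "s \<in> T" "t \<in> T" "f s = f t"
    then show "s = t"
      by (cases s; cases t; simp add: T_def image_iff; metis aa ab bb ar br)
  qed
  then have cardT: "card (f ` T) = 2 * card W + 1"
  proof -
    have "T = insert Root (Orig ` W \<union> Copy ` W)" "Root \<notin> Orig ` W \<union> Copy ` W" "Orig ` W \<inter> Copy ` W = {}"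
      by (auto simp: T_def)
    then have "card T = card (Orig ` W) + card (Copy ` W) + 1"
      using finW by (simp add: card_Un_disjoint)
    moreover have "card (Orig ` W) = card W" "card (Copy ` W) = card W"
      by (auto intro!: card_image inj_onI)
    ultimately show ?thesis using \<open>inj_on f T\<close> by (simp add: card_image)
  qed
  have TM: "T \<subseteq> pverts (mycielski_graph G)" using WV by (auto simp: T_def)
  \<comment> \<open>The free labels: \<open>?K + 1\<close> labels are available, and
    \<open>2 * card W + 1\<close> of them are taken by \<open>T\<close>.\<close>
  define F where "F = {..?K} - f ` T"
  have cardF: "card F = r + 2 * card S"
  proof -
    have "f ` T \<subseteq> {..?K}" using le TM by auto
    then have "card F = ?K + 1 - (2 * card W + 1)"
      using cardT by (simp add: F_def card_Diff_subset finite_subset)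
    moreover have "card W + card S = card ?V"
      using SV pair_finite_verts unfolding W_def
      by (metis card_Diff_subset card_mono finite_subset le_add_diff_inverse2)
    ultimately show ?thesis by linarith
  qed
  \<comment> \<open>The labels next to that of a vertex of \<open>X\<close> are out of range, free, that of its copy, or that of the root.\<close>
  have side: "?a y \<noteq> ?a x + 1" "?a x \<noteq> ?a y + 1" "x \<noteq> y \<Longrightarrow> ?a x \<noteq> ?b y + 1" "x \<noteq> y \<Longrightarrow> ?b y \<noteq> ?a x + 1"
    if xy: "x \<in> X" "y \<in> W" for x y
    using far[of "Orig x" "Orig y"] far[of "Orig x" "Copy y"] adj[OF xy] by (cases "x = y"; auto)+
  \<comment> \<open>\<open>C\<close> and \<open>D\<close> contain the vertices whose copy comes
    directly after, respectively directly before them. They are disjoint, so the copies account for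
    at most \<open>card X\<close> of the neighbouring labels.\<close>
  define C where "C = {x \<in> X. ?b x = ?a x + 1}"
  define D where "D = {x \<in> X. ?a x = ?b x + 1}"
  have "(\<lambda>x. ?a x + 1) ` X \<subseteq> {?K + 1, f Root} \<union> F \<union> ?b ` C"
  proof
    fix l assume "l \<in> (\<lambda>x. ?a x + 1) ` X"
    then obtain x where x: "x \<in> X" "l = ?a x + 1" by blast
    have "?a x \<le> ?K" using le x X by auto
    show "l \<in> {?K + 1, f Root} \<union> F \<union> ?b ` C"
    proof (cases "l \<in> f ` T")
      case True
      then obtain t where t: "t \<in> T" "l = f t" by blast
      show ?thesis
      proof (cases t)
        case (Orig y)
        then show ?thesis using t x side(1)[OF x(1), of y] by (auto simp: T_def)
      next
        case (Copy y)
        then have "x = y" using t x side(4)[OF x(1), of y] by (auto simp: T_def)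
        then have "x \<in> C" "l = ?b x" using Copy t x by (auto simp: C_def)
        then show ?thesis by blast
      qed (use t in auto)
    next
      case False
      then show ?thesis using \<open>?a x \<le> ?K\<close> x by (auto simp: F_def)
    qed
  qed
  then have "card ((\<lambda>x. ?a x + 1) ` X) \<le> card ({?K + 1, f Root} \<union> F \<union> ?b ` C)"
    by (intro card_mono) (auto simp: F_def C_def finX)
  moreover have "inj_on (\<lambda>x. ?a x + 1) X" using aa XW by (auto simp: inj_on_def)
  moreover have "card ({?K + 1, f Root} \<union> F \<union> ?b ` C) \<le> card {?K + 1, f Root} + card F + card (?b ` C)"
    by (meson add_le_mono1 card_Un_le le_trans)
  moreover have "card {?K + 1, f Root} \<le> 2" by (simp add: card_insert_if)
  moreover have "card (?b ` C) \<le> card C" by (rule card_image_le) (simp add: C_def finX)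
  ultimately have up: "card X \<le> 2 + card F + card C" by (simp add: card_image)
  \<comment> \<open>The labels below are treated without predecessors by shifting everything up by
    one; \<open>0\<close> then stands for a predecessor out of range.\<close>
  have "?a ` X \<subseteq> {0, f Root + 1} \<union> Suc ` F \<union> (\<lambda>x. ?b x + 1) ` D"
  proof
    fix l assume "l \<in> ?a ` X"
    then obtain x where x: "x \<in> X" "l = ?a x" by blast
    have "?a x \<le> ?K" using le x X by auto
    show "l \<in> {0, f Root + 1} \<union> Suc ` F \<union> (\<lambda>x. ?b x + 1) ` D"
    proof (cases l)
      case (Suc m)
      show ?thesis
      proof (cases "m \<in> f ` T")
        case True
        then obtain t where t: "t \<in> T" "m = f t" by blast
        show ?thesis
        proof (cases t)
          case (Orig y)
          then show ?thesis using t x Suc side(2)[OF x(1), of y] by (auto simp: T_def)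
        next
          case (Copy y)
          then have "x = y" using t x Suc side(3)[OF x(1), of y] by (auto simp: T_def)
          then have "x \<in> D" "l = ?b x + 1" using Copy t x Suc by (auto simp: D_def)
          then show ?thesis by blast
        qed (use t Suc in auto)
      next
        case False
        then have "m \<in> F" using \<open>?a x \<le> ?K\<close> x Suc by (auto simp: F_def)
        then show ?thesis using Suc by blast
      qed
    qed simp
  qed
  then have "card (?a ` X) \<le> card ({0, f Root + 1} \<union> Suc ` F \<union> (\<lambda>x. ?b x + 1) ` D)"
    by (intro card_mono) (auto simp: F_def D_def finX)
  moreover have "inj_on ?a X" using aa XW by (auto simp: inj_on_def)
  moreover have "card ({0, f Root + 1} \<union> Suc ` F \<union> (\<lambda>x. ?b x + 1) ` D)
      \<le> card {0, f Root + 1} + card (Suc ` F) + card ((\<lambda>x. ?b x + 1) ` D)"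
    by (meson add_le_mono1 card_Un_le le_trans)
  moreover have "card {0, f Root + 1} \<le> 2" by (simp add: card_insert_if)
  moreover have "card ((\<lambda>x. ?b x + 1) ` D) \<le> card D" by (rule card_image_le) (simp add: D_def finX)
  ultimately have down: "card X \<le> 2 + card F + card D" by (simp add: card_image)
  have "card C + card D = card (C \<union> D)"
    using finX by (subst card_Un_disjoint) (auto simp: C_def D_def)
  also have "\<dots> \<le> card X" using finX by (intro card_mono) (auto simp: C_def D_def)
  finally show ?thesis using up down cardF unfolding S_def by linarith
qed simp

section \<open>Labelings from star forests\<close>

definition label_compatible :: "'a pair_pre_digraph \<Rightarrow> 'a option \<Rightarrow> 'a option \<Rightarrow> bool" where
  "label_compatible G a b \<longleftrightarrow> (\<forall>x y. a = Some x \<longrightarrow> b = Some y \<longrightarrow> (x, y) \<notin> parcs G)"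

lemma successively_nthD:
  "successively P xs \<Longrightarrow> Suc i < length xs \<Longrightarrow> P (xs ! i) (xs ! Suc i)"
  by (induction P xs arbitrary: i rule: successively.induct) (auto simp: nth_Cons split: nat.split)

text \<open>The entries \<open>None\<close> are the labels that are not used.\<close>

lemma L21_labeling_of_list:
  assumes "pair_graph G" "successively (label_compatible G) xs" "Some ` pverts G \<subseteq> set xs"
  shows "\<exists>f. L21_labeling G f \<and> (\<forall>x \<in> pverts G. f x < length xs)"
proof -
  interpret pair_graph G by fact
  have "\<forall>x \<in> pverts G. \<exists>i < length xs. xs ! i = Some x"
    using assms(3) by (auto simp: in_set_conv_nth subset_iff image_iff)
  \<comment> \<open>The label of a vertex is a position at which it occurs in the list.\<close>
  then obtain f where f: "\<And>x. x \<in> pverts G \<Longrightarrow> f x < length xs \<and> xs ! f x = Some x"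
    by metis
  have step: "f y \<noteq> Suc (f x)" if "(x, y) \<in> parcs G" for x y
    using successively_nthD[OF assms(2), of "f x"] f[of x] f[of y] that in_arcsD1[OF that] in_arcsD2[OF that]
    by (auto simp: label_compatible_def)
  have "inj_on f (pverts G)"
    using f by (metis inj_onI option.inject)
  moreover have "\<bar>int (f x) - int (f y)\<bar> \<ge> 2" if xy: "(x, y) \<in> parcs G" for x y
  proof -
    have "f x \<noteq> f y"
      using \<open>inj_on f _\<close> in_arcsD1[OF xy] in_arcsD2[OF xy] no_loops'[OF xy] by (simp add: inj_on_eq_iff)
    then show ?thesis using step[OF xy] step[OF arcs_symmetric[OF xy]] by linarith
  qed
  ultimately have "L21_labeling G f" by (rule L21_labelingI[OF assms(1)])
  then show ?thesis using f by blast
qed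

text \<open>
  A segment labels the vertices over \<open>W\<close> with at most \<open>h\<close> gaps; since copies are pairwise
  non-adjacent, segments that begin and end with a copy or a gap can be concatenated.
\<close>

definition segment_end :: "'a mycielski_vertex option \<Rightarrow> bool" where
  "segment_end a \<longleftrightarrow> a = None \<or> (\<exists>x. a = Some (Copy x))"

definition segment :: "'a pair_pre_digraph \<Rightarrow> 'a set \<Rightarrow> nat \<Rightarrow> 'a mycielski_vertex option list \<Rightarrow> bool" where
  "segment G W h xs \<longleftrightarrow> successively (label_compatible (mycielski_graph G)) xs \<and>
    (\<forall>v \<in> W. Some (Orig v) \<in> set xs \<and> Some (Copy v) \<in> set xs) \<and> length xs \<le> 2 * card W + h \<and>
    (xs \<noteq> [] \<longrightarrow> segment_end (hd xs) \<and> segment_end (last xs))"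

lemma label_compatible_segment_end:
  "segment_end a \<Longrightarrow> segment_end b \<Longrightarrow> label_compatible (mycielski_graph G) a b"
  by (auto simp: segment_end_def label_compatible_def)

lemma segment_append:
  assumes "segment G W h xs" "segment G W' h' ys" "finite W" "finite W'" "W \<inter> W' = {}"
  shows "segment G (W \<union> W') (h + h') (xs @ ys)"
  using assms by (auto simp: segment_def successively_append_iff hd_append last_append
      card_Un_disjoint label_compatible_segment_end)

lemma segment_star:
  assumes G: "pair_graph G" and B: "finite B" "B \<noteq> {}" "card B \<le> 4" "c \<notin> B"
    and edges: "\<And>b. b \<in> B \<Longrightarrow> (b, c) \<in> parcs (complement_graph G)"
  shows "\<exists>xs. segment G (insert c B) 0 xs"
proof -
  interpret pair_graph G by fact
  obtain ys where ys: "set ys = B" "distinct ys" using finite_distinct_list[OF B(1)] by blast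
  have len: "length ys = card B" using ys distinct_card by fastforce
  have non: "(b, c) \<notin> parcs G \<and> (c, b) \<notin> parcs G" if "b \<in> B" for b
    using edges[OF that] arcs_symmetric by (auto simp: complement_graph_def)
  have loop: "(x, x) \<notin> parcs G" for x using no_loops' by blast
  have "length ys = 1 \<or> length ys = 2 \<or> length ys = 3 \<or> length ys = 4"
    using B len by (cases ys) auto
  then consider b1 where "ys = [b1]" | b1 b2 where "ys = [b1, b2]" | b1 b2 b3 where "ys = [b1, b2, b3]"
    | b1 b2 b3 b4 where "ys = [b1, b2, b3, b4]"
    by (auto simp: length_Suc_conv numeral_eq_Suc)
  then show ?thesis
  proof cases
    case (1 b1)
    let ?xs = "map Some [Copy b1, Orig b1, Orig c, Copy c]"
    have "segment G (insert c B) 0 ?xs"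
      using 1 ys B(1,4) non len loop by (auto simp: segment_def segment_end_def label_compatible_def)
    then show ?thesis by blast
  next
    case (2 b1 b2)
    let ?xs = "map Some [Copy b1, Orig b1, Orig c, Orig b2, Copy b2, Copy c]"
    have "segment G (insert c B) 0 ?xs"
      using 2 ys B(1,4) non len loop by (auto simp: segment_def segment_end_def label_compatible_def)
    then show ?thesis by blast
  next
    case (3 b1 b2 b3)
    let ?xs = "map Some [Copy b1, Orig b1, Orig c, Orig b2, Copy b2, Copy b3, Orig b3, Copy c]"
    have "segment G (insert c B) 0 ?xs"
      using 3 ys B(1,4) non len loop by (auto simp: segment_def segment_end_def label_compatible_def)
    then show ?thesis by blast
  next
    case (4 b1 b2 b3 b4)
    let ?xs = "map Some [Copy b1, Orig b1, Orig c, Orig b2, Copy b2, Copy b3, Orig b3, Copy c, Orig b4, Copy b4]"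
    have "segment G (insert c B) 0 ?xs"
      using 4 ys B(1,4) non len loop by (auto simp: segment_def segment_end_def label_compatible_def)
    then show ?thesis by blast
  qed
qed

lemma segment_star_forest:
  assumes G: "pair_graph G" and sf: "star_forest 4 (parcs (complement_graph G)) L g"
  shows "\<exists>xs. segment G (L \<union> g ` L) 0 xs"
proof -
  have finL: "finite L" and disj: "g ` L \<inter> L = {}"
    and edges: "\<And>v. v \<in> L \<Longrightarrow> (v, g v) \<in> parcs (complement_graph G)"
    and cap: "\<And>w. card {v \<in> L. g v = w} \<le> 4"
    using sf by (auto simp: star_forest_def)
  \<comment> \<open>Centres are taken with all their leaves, so the induction adds one complete star
    at a time.\<close>
  have "\<exists>xs. segment G ({v \<in> L. g v \<in> C} \<union> C) 0 xs" if "finite C" "C \<subseteq> g ` L" for C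
    using that
  proof (induction C rule: finite_induct)
    case empty
    have "segment G {} 0 []" by (simp add: segment_def)
    then show ?case by auto
  next
    case (insert c C)
    then obtain xs where xs: "segment G ({v \<in> L. g v \<in> C} \<union> C) 0 xs" by auto
    let ?B = "{v \<in> L. g v = c}"
    have "\<exists>ys. segment G (insert c ?B) 0 ys"
    proof (rule segment_star[OF G])
      show "(b, c) \<in> parcs (complement_graph G)" if "b \<in> ?B" for b using that edges[of b] by simp
    qed (use insert.prems disj finL cap in auto)
    then obtain ys where ys: "segment G (insert c ?B) 0 ys" by blast
    have "insert c ?B \<inter> ({v \<in> L. g v \<in> C} \<union> C) = {}"
      using insert.prems insert.hyps disj by auto
    then have "segment G (insert c ?B \<union> ({v \<in> L. g v \<in> C} \<union> C)) 0 (ys @ xs)"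
      using segment_append[OF ys xs] finL insert.hyps by simp
    moreover have "insert c ?B \<union> ({v \<in> L. g v \<in> C} \<union> C) = {v \<in> L. g v \<in> insert c C} \<union> insert c C"
      by auto
    ultimately show ?case by metis
  qed
  moreover have "{v \<in> L. g v \<in> g ` L} \<union> g ` L = L \<union> g ` L" by blast
  ultimately show ?thesis using finL by (metis finite_imageI order_refl)
qed

text \<open>Two originals may be adjacent in \<open>G\<close>, but one gap separates them, so a gap
  serves two vertices. A vertex left over uses a gap of its own, which closes the segment after its
  original.\<close>

lemma segment_gaps:
  assumes G: "pair_graph G"
  shows "finite U \<Longrightarrow> card U \<le> 2 * h \<Longrightarrow> \<exists>xs. segment G U h xs"
proof (induction h arbitrary: U)
  case 0
  then have "segment G U 0 []" by (simp add: segment_def)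
  then show ?case by blast
next
  case (Suc h)
  interpret pair_graph G by fact
  have loop: "(x, x) \<notin> parcs G" for x using no_loops' by blast
  consider "U = {}" | v where "U = {v}" | v w where "v \<in> U" "w \<in> U" "v \<noteq> w"
    by blast
  then show ?case
  proof cases
    case 1
    then have "segment G U (Suc h) []" by (simp add: segment_def)
    then show ?thesis by blast
  next
    case (2 v)
    then have "segment G U (Suc h) [Some (Copy v), Some (Orig v), None]"
      using loop by (simp add: segment_def segment_end_def label_compatible_def)
    then show ?thesis by blast
  next
    case (3 v w)
    let ?U = "U - {v, w}"
    have U: "U = {v, w} \<union> ?U" using 3 by blast
    have "card U = 2 + card ?U"
      using 3 Suc.prems(1) by (subst U, subst card_Un_disjoint) auto
    then obtain xs where xs: "segment G ?U h xs" using Suc by fastforce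
    have vw: "segment G {v, w} 1 [Some (Copy v), Some (Orig v), None, Some (Orig w), Some (Copy w)]"
      using loop 3 by (simp add: segment_def segment_end_def label_compatible_def)
    from segment_append[OF vw xs] have "\<exists>xs. segment G ({v, w} \<union> ?U) (Suc h) xs"
      using Suc.prems(1) by auto
    then show ?thesis using U by simp
  qed
qed

text \<open>Originals may stand at the two ends of the whole list and on both sides of the root, so
  up to four further vertices fit without gaps. As \<open>m\<close> may end with a copy, the root
  needs an original in between, which is why \<open>us\<close> is nonempty.\<close>

lemma labeling_of_segment:
  assumes G: "pair_graph G" and m: "segment G W h m" and "finite W"
    and us: "us \<noteq> []" "length us \<le> 4" "distinct us" "set us \<inter> W = {}" "set us \<union> W = pverts G"
  shows "\<exists>f. L21_labeling (mycielski_graph G) f \<and>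
    (\<forall>x \<in> pverts (mycielski_graph G). f x \<le> 2 * card (pverts G) + h)"
proof -
  interpret pair_graph G by fact
  have loop: "(x, x) \<notin> parcs G" for x using no_loops' by blast
  have card: "card (pverts G) = length us + card W"
    using us \<open>finite W\<close> by (metis List.finite_set card_Un_disjoint distinct_card)
  have len: "length m \<le> 2 * card W + h" and succ: "successively (label_compatible (mycielski_graph G)) m"
    and ends: "m \<noteq> [] \<Longrightarrow> segment_end (hd m)" "m \<noteq> [] \<Longrightarrow> segment_end (last m)"
    and sub: "\<And>v. v \<in> W \<Longrightarrow> Some (Orig v) \<in> set m \<and> Some (Copy v) \<in> set m"
    using m by (auto simp: segment_def)
  have join: "label_compatible (mycielski_graph G) (Some (Copy a)) (hd m)"
      "label_compatible (mycielski_graph G) (last m) (Some (Copy a))" if "m \<noteq> []" for a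
    using ends that by (auto intro!: label_compatible_segment_end simp: segment_end_def)
  have verts: "pverts (mycielski_graph G) = insert Root (Orig ` (set us \<union> W) \<union> Copy ` (set us \<union> W))"
    using us(5) by (auto simp: mycielski_graph_def)
  \<comment> \<open>One extra place is allowed, since labels start at \<open>0\<close>; it is taken
    by the root.\<close>
  have *: ?thesis if "length xs \<le> 2 * card (pverts G) + h + 1"
      "successively (label_compatible (mycielski_graph G)) xs"
      "Some Root \<in> set xs" "set m \<subseteq> set xs"
      "\<And>v. v \<in> set us \<Longrightarrow> Some (Orig v) \<in> set xs \<and> Some (Copy v) \<in> set xs" for xs
  proof -
    have "Some ` pverts (mycielski_graph G) \<subseteq> set xs"
      unfolding verts using that sub by auto
    from L21_labeling_of_list[OF pair_graph_mycielski[OF G] that(2) this]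
    show ?thesis using that(1) by fastforce
  qed
  consider a where "us = [a]" | a b where "us = [a, b]" | a b c where "us = [a, b, c]"
    | a b c d where "us = [a, b, c, d]"
    \<comment> \<open>The rule serves only to split lists by length zero, one, or at least
      two.\<close>
    using us(1,2) by (cases us rule: remdups_adj.cases; cases "tl (tl us)"; cases "tl (tl (tl us))") auto
  then show ?thesis
  proof cases
    case (1 a)
    show ?thesis
      by (rule *[of "m @ [Some (Copy a), Some (Orig a), Some Root]"])
        (use 1 len card succ join loop in \<open>auto simp: successively_append_iff label_compatible_def\<close>)
  next
    case (2 a b)
    show ?thesis
      by (rule *[of "[Some (Orig b), Some (Copy b)] @ m @ [Some (Copy a), Some (Orig a), Some Root]"])
        (use 2 len card succ join loop in \<open>auto simp: successively_append_iff successively_Cons hd_append label_compatible_def\<close>)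
  next
    case (3 a b c)
    show ?thesis
      by (rule *[of "[Some (Orig b), Some (Copy b)] @ m @
            [Some (Copy a), Some (Orig a), Some Root, Some (Orig c), Some (Copy c)]"])
        (use 3 len card succ join loop in \<open>auto simp: successively_append_iff successively_Cons hd_append label_compatible_def\<close>)
  next
    case (4 a b c d)
    show ?thesis
      by (rule *[of "[Some (Orig b), Some (Copy b)] @ m @
            [Some (Copy a), Some (Orig a), Some Root, Some (Orig c), Some (Copy c), Some (Copy d), Some (Orig d)]"])
        (use 4 len card succ join loop in \<open>auto simp: successively_append_iff successively_Cons hd_append label_compatible_def\<close>)
  qed
qed

text \<open>The stars need no gaps. Up to four uncovered vertices go to the ends of the list and
  next to the root, and the remaining ones, at most \<open>2 * r\<close>, use \<open>r\<close>
  gaps.\<close>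

lemma mycielski_labeling_of_star_forest:
  assumes G: "pair_graph G" and sf: "star_forest 4 (parcs (complement_graph G)) L g"
    and le: "card (pverts G - (L \<union> g ` L)) \<le> 2 * r + 4"
  shows "\<exists>f. L21_labeling (mycielski_graph G) f \<and>
    (\<forall>x \<in> pverts (mycielski_graph G). f x \<le> 2 * card (pverts G) + r)"
proof -
  interpret pair_graph G by fact
  have uncovered: ?thesis
    if sf: "star_forest 4 (parcs (complement_graph G)) L g"
      and le: "card (pverts G - (L \<union> g ` L)) \<le> 2 * r + 4" and ne: "pverts G - (L \<union> g ` L) \<noteq> {}" for L g
  proof -
    let ?U = "pverts G - (L \<union> g ` L)"
    have finL: "finite L" using sf by (simp add: star_forest_def)
    have sub: "L \<union> g ` L \<subseteq> pverts G"
      using sf by (auto simp: star_forest_def complement_graph_def)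
    obtain us where us: "set us = ?U" "distinct us"
      using finite_distinct_list[of ?U] pair_finite_verts by blast
    have "length us = card ?U" using us distinct_card by fastforce
    then have "length us \<le> 2 * r + 4" using le by simp
    then have "card (set (drop 4 us)) \<le> 2 * r"
      using us(2) distinct_card[of "drop 4 us"] by simp
    then obtain ys where ys: "segment G (set (drop 4 us)) r ys" using segment_gaps[OF G] by blast
    obtain xs where xs: "segment G (L \<union> g ` L) 0 xs" using segment_star_forest[OF G sf] by blast
    have "(L \<union> g ` L) \<inter> set (drop 4 us) = {}" using us(1) set_drop_subset[of 4 us] by blast
    then have "segment G (L \<union> g ` L \<union> set (drop 4 us)) r (xs @ ys)"
      using segment_append[OF xs ys] finL by simp
    then show ?thesis
    proof (rule labeling_of_segment[OF G _ _, where us = "take 4 us"])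
      have un: "set (take 4 us) \<union> set (drop 4 us) = ?U"
        using us(1) by (metis append_take_drop_id set_append)
      have "set (take 4 us) \<inter> set (drop 4 us) = {}"
        using us(2) by (metis append_take_drop_id distinct_append)
      then show "set (take 4 us) \<inter> (L \<union> g ` L \<union> set (drop 4 us)) = {}"
        using un by blast
      show "set (take 4 us) \<union> (L \<union> g ` L \<union> set (drop 4 us)) = pverts G"
        using un sub by blast
    qed (use us ne finL in auto)
  qed
  show ?thesis
  proof (cases "pverts G - (L \<union> g ` L) = {}")
    case False
    then show ?thesis using uncovered[OF sf le] by blast
  next
    case covered: True
    show ?thesis
    proof (cases "L = {}")
      case True
      then have "pverts (mycielski_graph G) = {Root}" using covered by (auto simp: mycielski_graph_def)
      then have "Some ` pverts (mycielski_graph G) \<subseteq> set [Some Root]" by simp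
      from L21_labeling_of_list[OF pair_graph_mycielski[OF G] _ this] show ?thesis by auto
    next
      case False
      \<comment> \<open>The root needs an uncovered neighbour in the ordering, so one leaf is given up.\<close>
      then obtain l where l: "l \<in> L" by blast
      let ?L = "L - {l}"
      have finL: "finite L" using sf by (simp add: star_forest_def)
      have "card {v \<in> ?L. g v = w} \<le> 4" for w
      proof -
        have "card {v \<in> ?L. g v = w} \<le> card {v \<in> L. g v = w}"
          using finL by (intro card_mono) auto
        also have "\<dots> \<le> 4" using sf by (simp add: star_forest_def)
        finally show ?thesis .
      qed
      then have sf': "star_forest 4 (parcs (complement_graph G)) ?L g"
        using sf by (auto simp: star_forest_def)
      \<comment> \<open>Besides \<open>l\<close>, only its centre can become uncovered, namely if
        \<open>l\<close> was its only leaf.\<close>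
      have "pverts G - (?L \<union> g ` ?L) \<subseteq> {l, g l}" using covered by auto
      then have "card (pverts G - (?L \<union> g ` ?L)) \<le> card {l, g l}" by (intro card_mono) auto
      also have "\<dots> \<le> 2 * r + 4" by (simp add: card_insert_if)
      finally have le': "card (pverts G - (?L \<union> g ` ?L)) \<le> 2 * r + 4" .
      have "l \<in> pverts G - (?L \<union> g ` ?L)"
        using l sf by (auto simp: star_forest_def complement_graph_def)
      then show ?thesis using uncovered[OF sf' le'] by blast
    qed
  qed
qed

section \<open>Star forests as star matchings\<close>

text \<open>The map that sends leaves to their centres and fixes the centres is constant along arcs,
  hence on components; so the components are exactly the stars.\<close>

lemma star_matching_of_star_forest:
  assumes H: "pair_graph H" and sf: "star_forest k (parcs H) L g"
  shows "\<exists>S. star_matching k H S \<and> pverts S = L \<union> g ` L"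
proof -
  interpret H: pair_graph H by fact
  have finL: "finite L" and disj: "g ` L \<inter> L = {}" and edges: "\<And>v. v \<in> L \<Longrightarrow> (v, g v) \<in> parcs H"
    and cap: "\<And>w. card {v \<in> L. g v = w} \<le> k"
    using sf by (auto simp: star_forest_def)
  define A where "A = (\<lambda>v. (v, g v)) ` L \<union> (\<lambda>v. (g v, v)) ` L"
  define S where "S = \<lparr>pverts = L \<union> g ` L, parcs = A\<rparr>"
  have S: "pverts S = L \<union> g ` L" "parcs S = A" by (simp_all add: S_def)
  have A_iff: "(v, w) \<in> A \<longleftrightarrow> v \<in> L \<and> w = g v \<or> w \<in> L \<and> v = g w" for v w
    by (auto simp: A_def)
  have pgS: "pair_graph S"
    using finL disj by unfold_locales (auto simp: S_def A_def symmetric_def sym_def)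
  then interpret S: pair_graph S .
  have "subgraph (with_proj S) (with_proj H)"
    unfolding subgraph_def wf_digraph_wp_iff
    using edges H.arcs_symmetric H.pair_wf_digraph S.pair_wf_digraph
    by (auto simp: S A_def dest: H.in_arcsD1 H.in_arcsD2)
  moreover have "\<exists>i \<in> {1..k}. K\<^bsub>1,i\<^esub> C" if scc: "C \<in> S.sccs" for C
  proof -
    define centre where "centre v = (if v \<in> L then g v else v)" for v
    obtain u where u: "u \<in> L \<union> g ` L" "C = with_proj S \<restriction> S.scc_of u"
      using scc by (auto simp: S.sccs_conv_sccs_verts S.sccs_verts_conv_scc_of S)
    define B where "B = {v \<in> L. g v = centre u}"
    have c: "centre u \<in> g ` L" "centre u \<notin> L"
      using u(1) disj by (auto simp: centre_def)
    have same: "centre v = centre w" if "(v, w) \<in> A" for v w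
      using that disj by (auto simp: A_iff centre_def)
    have "S.scc_of u = insert (centre u) B"
    proof
      show "S.scc_of u \<subseteq> insert (centre u) B"
      proof
        fix v assume "v \<in> S.scc_of u"
        then have reach: "u \<rightarrow>\<^sup>*\<^bsub>with_proj S\<^esub> v" by (simp add: S.scc_of_def)
        then have "centre v = centre u"
        proof (induction rule: S.reachable_induct)
          case (step x y)
          then show ?case using same[of x y] by (simp add: S)
        qed simp
        moreover have "v \<in> L \<union> g ` L" using S.reachable_in_verts(2)[OF reach] by (simp add: S)
        ultimately show "v \<in> insert (centre u) B" by (auto simp: B_def centre_def split: if_splits)
      qed
      have self: "v \<rightarrow>\<^sup>*\<^bsub>with_proj S\<^esub> centre v \<and> centre v \<rightarrow>\<^sup>*\<^bsub>with_proj S\<^esub> v"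
        if "v \<in> L \<union> g ` L" for v
        using that by (auto simp: centre_def S A_iff)
      show "insert (centre u) B \<subseteq> S.scc_of u"
      proof
        fix v assume v: "v \<in> insert (centre u) B"
        then have "v \<in> L \<union> g ` L" "centre v = centre u"
          using c by (auto simp: B_def centre_def)
        then have "u \<rightarrow>\<^sup>*\<^bsub>with_proj S\<^esub> v" "v \<rightarrow>\<^sup>*\<^bsub>with_proj S\<^esub> u"
          using self[of v] self[OF u(1)] by (auto intro: S.reachable_trans)
        then show "v \<in> S.scc_of u" by (simp add: S.scc_of_def)
      qed
    qed
    moreover have "{e \<in> A. fst e \<in> insert (centre u) B \<and> snd e \<in> insert (centre u) B}
        = {centre u} \<times> B \<union> B \<times> {centre u}"
      using c(2) by (auto simp: A_iff B_def)
    ultimately have C: "C = with_proj \<lparr>pverts = insert (centre u) B, parcs = {centre u} \<times> B \<union> B \<times> {centre u}\<rparr>"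
      by (simp add: u(2) induce_subgraph_def with_proj_def S)
    have finB: "finite B" using finL by (simp add: B_def)
    have "centre u \<notin> B" using c(2) by (simp add: B_def)
    then have "K\<^bsub>1,card B\<^esub> C"
      unfolding C complete_bipartite_digraph_pair_def using finB
      by (intro conjI exI[of _ "{centre u}"] exI[of _ B]) auto
    moreover have "B \<noteq> {}" using c(1) by (auto simp: B_def)
    then have "card B \<in> {1..k}" using finB cap by (auto simp: B_def Suc_le_eq card_gt_0_iff)
    ultimately show ?thesis by blast
  qed
  ultimately have "star_matching k H S" using pgS by (simp add: star_matching_def)
  then show ?thesis by (auto simp: S)
qed

text \<open>In each component the side of size one provides the centre, and all other vertices
  become leaves.\<close>

lemma star_forest_of_star_matching:
  assumes "star_matching k H S"
  shows "\<exists>L g. star_forest k (parcs H) L g \<and> L \<union> g ` L = pverts S"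
proof -
  have pgS: "pair_graph S" and sub: "subgraph (with_proj S) (with_proj H)"
    and stars: "\<And>C. C \<in> pre_digraph.sccs (with_proj S) \<Longrightarrow> \<exists>i \<in> {1..k}. K\<^bsub>1,i\<^esub> C"
    using assms by (auto simp: star_matching_def)
  interpret S: pair_graph S by fact
  have "\<exists>c B. X = insert c B \<and> c \<notin> B \<and> B \<noteq> {} \<and> finite B \<and> card B \<le> k \<and> (\<forall>b \<in> B. (b, c) \<in> parcs S)"
    if X: "X \<in> S.sccs_verts" for X
  proof -
    have "with_proj S \<restriction> X \<in> S.sccs" using X by (rule S.in_verts_sccsD_sccs)
    from stars[OF this] obtain i where i: "1 \<le> i" "i \<le> k" and K: "K\<^bsub>1,i\<^esub> (with_proj S \<restriction> X)"
      by auto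
    obtain U B where UB: "X = U \<union> B" "U \<inter> B = {}" "card U = 1" "card B = i"
        "arcs_ends (with_proj S \<restriction> X) = U \<times> B \<union> B \<times> U"
      using K by (auto simp: complete_bipartite_digraph_def)
    obtain c where c: "U = {c}" using UB(3) card_1_singletonE by blast
    have "(b, c) \<in> parcs S" if "b \<in> B" for b
    proof -
      have "(b, c) \<in> arcs_ends (with_proj S \<restriction> X)" using UB(5) c that by simp
      then show ?thesis by (auto simp: arcs_ends_conv)
    qed
    then show ?thesis
      using UB c i by (intro exI[of _ c] exI[of _ B]) (auto simp: card_ge_0_finite)
  qed
  then obtain c B where cB: "\<And>X. X \<in> S.sccs_verts \<Longrightarrow> X = insert (c X) (B X) \<and> c X \<notin> B X \<and> B X \<noteq> {} \<and>
      finite (B X) \<and> card (B X) \<le> k \<and> (\<forall>b \<in> B X. (b, c X) \<in> parcs S)"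
    by metis
  define g where "g u = c (S.scc_of u)" for u
  define L where "L = {u \<in> pverts S. g u \<noteq> u}"
  have scc: "S.scc_of u = insert (g u) (B (S.scc_of u))" "g u \<notin> B (S.scc_of u)" "B (S.scc_of u) \<noteq> {}"
      "finite (B (S.scc_of u))" "card (B (S.scc_of u)) \<le> k" "\<And>b. b \<in> B (S.scc_of u) \<Longrightarrow> (b, g u) \<in> parcs S"
    if "u \<in> pverts S" for u
    using cB[OF S.scc_of_in_sccs_verts[OF that]] by (auto simp: g_def)
  have scc_cases: "v = g u \<or> v \<in> B (S.scc_of u)" if "u \<in> pverts S" "v \<in> S.scc_of u" for u v
    using equalityD1[OF scc(1)[OF that(1)]] that(2) by blast
  have in_verts: "v \<in> pverts S" if "v \<in> S.scc_of u" for u v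
    using that S.reachable_in_verts(2) by (auto simp: S.scc_of_def)
  have same: "S.scc_of v = S.scc_of u" "g v = g u" if "v \<in> S.scc_of u" for u v
    using S.scc_of_eq[OF that] by (auto simp: g_def)
  have g_in: "g u \<in> S.scc_of u" if "u \<in> pverts S" for u using scc(1)[OF that] by blast
  have leaf: "u \<in> B (S.scc_of u)" if "u \<in> L" for u
    using that scc_cases[of u u] S.in_scc_of_self[of u] by (auto simp: L_def)
  have "star_forest k (parcs H) L g"
    unfolding star_forest_def
  proof (intro conjI ballI allI)
    show "finite L" using S.pair_finite_verts by (simp add: L_def)
    show "g ` L \<inter> L = {}" using same(2)[OF g_in] by (auto simp: L_def)
    show "(v, g v) \<in> parcs H" if "v \<in> L" for v
      using scc(6)[OF _ leaf[OF that]] that sub by (auto simp: L_def subgraph_def)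
    show "card {v \<in> L. g v = w} \<le> k" for w
    proof (cases "{v \<in> L. g v = w} = {}")
      case False
      then obtain v where v: "v \<in> L" "g v = w" by blast
      have vS: "v \<in> pverts S" using v by (simp add: L_def)
      have "{v \<in> L. g v = w} \<subseteq> B (S.scc_of v)"
      proof
        fix x assume x: "x \<in> {v \<in> L. g v = w}"
        then have "S.scc_of w = S.scc_of x" "S.scc_of w = S.scc_of v"
          using v vS same(1)[OF g_in, of x] same(1)[OF g_in, of v] by (simp_all add: L_def)
        then show "x \<in> B (S.scc_of v)" using leaf[of x] x by simp
      qed
      from card_mono[OF scc(4)[OF vS] this] show ?thesis using scc(5)[OF vS] by simp
    next
      case True
      show ?thesis unfolding True by simp
    qed
  qed
  moreover have "L \<union> g ` L = pverts S"
  proof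
    show "L \<union> g ` L \<subseteq> pverts S" using in_verts[OF g_in] by (auto simp: L_def)
    show "pverts S \<subseteq> L \<union> g ` L"
    proof
      fix u assume u: "u \<in> pverts S"
      show "u \<in> L \<union> g ` L"
      proof (cases "u \<in> L")
        case False
        then have "g u = u" using u by (simp add: L_def)
        \<comment> \<open>A centre is in the image of \<open>g\<close> because its star has at least
          one leaf.\<close>
        obtain b where b: "b \<in> B (S.scc_of u)" using scc(3)[OF u] by blast
        have bs: "b \<in> S.scc_of u" "b \<noteq> u"
          using b equalityD2[OF scc(1)[OF u]] scc(2)[OF u] \<open>g u = u\<close> by auto
        then have "g b = u" "b \<in> L" using same(2)[OF bs(1)] in_verts[OF bs(1)] \<open>g u = u\<close> by (auto simp: L_def)
        then show ?thesis by blast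
      qed simp
    qed
  qed
  ultimately show ?thesis by blast
qed

section \<open>The equivalence for all bounds\<close>

lemma i4_le_iff:
  assumes H: "pair_graph H"
  shows "i4 H \<le> d \<longleftrightarrow> (\<exists>L g. star_forest 4 (parcs H) L g \<and> card (pverts H - (L \<union> g ` L)) \<le> d)"
proof -
  interpret pair_graph H by fact
  let ?O = "{card (pverts S) | S. star_matching 4 H S}"
  \<comment> \<open>\<open>S\<close> lies inside \<open>H\<close>, so the truncated subtraction in
    \<open>i4\<close> is exact.\<close>
  have diff: "card (pverts H - pverts S) = card (pverts H) - card (pverts S)"
    if "star_matching 4 H S" for S
    using that pair_finite_verts by (auto simp: star_matching_def subgraph_def intro!: card_Diff_subset intro: finite_subset)
  show ?thesis
  proof
    assume le: "i4 H \<le> d"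
    have "s4 H \<in> ?O" unfolding s4_def using star_matching_orders[OF H] by (rule Max_in)
    then obtain S where S: "star_matching 4 H S" "s4 H = card (pverts S)" by blast
    then obtain L g where "star_forest 4 (parcs H) L g" "L \<union> g ` L = pverts S"
      using star_forest_of_star_matching by blast
    then show "\<exists>L g. star_forest 4 (parcs H) L g \<and> card (pverts H - (L \<union> g ` L)) \<le> d"
      using le S diff[OF S(1)] unfolding i4_def by metis
  next
    assume "\<exists>L g. star_forest 4 (parcs H) L g \<and> card (pverts H - (L \<union> g ` L)) \<le> d"
    then obtain L g where Lg: "star_forest 4 (parcs H) L g" "card (pverts H - (L \<union> g ` L)) \<le> d" by blast
    then obtain S where S: "star_matching 4 H S" "pverts S = L \<union> g ` L"
      using star_matching_of_star_forest[OF H] by blast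
    have "card (pverts S) \<le> s4 H"
      unfolding s4_def using star_matching_orders(1)[OF H] S(1) by (intro Max_ge) auto
    then show "i4 H \<le> d" using Lg(2) diff[OF S(1)] S(2) by (simp add: i4_def)
  qed
qed

text \<open>From left to right, the clique bound is the hypothesis of the deficiency theorem with
  \<open>d = 2 * r + 4\<close>; the converse is the construction from a star forest.\<close>

lemma L21_number_mycielski_le_iff:
  assumes G: "pair_graph G"
  shows "L21_number (mycielski_graph G) \<le> 2 * card (pverts G) + r
    \<longleftrightarrow> i4 (complement_graph G) \<le> 2 * r + 4"
proof -
  interpret G: pair_graph G by fact
  interpret H: pair_graph "complement_graph G" by (rule pair_graph_complement[OF G])
  let ?E = "parcs (complement_graph G)"
  have V: "pverts (complement_graph G) = pverts G" by (simp add: complement_graph_def)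
  have "pverts (mycielski_graph G) \<noteq> {}" by (auto simp: mycielski_graph_def)
  note num = L21_number_le_iff[OF pair_graph_mycielski[OF G] this]
  show ?thesis
    unfolding num i4_le_iff[OF H.pair_graph] V
  proof
    assume "\<exists>f. L21_labeling (mycielski_graph G) f \<and>
      (\<forall>x \<in> pverts (mycielski_graph G). f x \<le> 2 * card (pverts G) + r)"
    then obtain f where f: "L21_labeling (mycielski_graph G) f"
        "\<forall>x \<in> pverts (mycielski_graph G). f x \<le> 2 * card (pverts G) + r" by blast
    show "\<exists>L g. star_forest 4 ?E L g \<and> card (pverts G - (L \<union> g ` L)) \<le> 2 * r + 4"
    proof (rule star_forest_deficiency)
      show "card X \<le> 4 * card (?E `` X) + (2 * r + 4)" if "X \<subseteq> pverts G" "X \<inter> ?E `` X = {}" for X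
        using mycielski_labeling_bound[OF G f that] .
      show "sym ?E" using H.arcs_symmetric by (auto intro: symI)
      show "irrefl ?E" using H.no_loops' by (auto simp: irrefl_def)
      show "?E \<subseteq> pverts G \<times> pverts G" by (auto simp: complement_graph_def)
    qed (use G.pair_finite_verts in auto)
  next
    assume "\<exists>L g. star_forest 4 ?E L g \<and> card (pverts G - (L \<union> g ` L)) \<le> 2 * r + 4"
    then show "\<exists>f. L21_labeling (mycielski_graph G) f \<and>
      (\<forall>x \<in> pverts (mycielski_graph G). f x \<le> 2 * card (pverts G) + r)"
      using mycielski_labeling_of_star_forest[OF G] by blast
  qed
qed

theorem theorem3p4:
  fixes G :: "'a pair_pre_digraph" and n :: nat
  assumes "pair_graph G"
    and "card (pverts G) = n"
  shows "(L21_number (mycielski_graph G) \<le> 2 * n \<longleftrightarrow> i4 (complement_graph G) \<le> 4)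
    \<and> (\<forall>r::nat. r > 0 \<longrightarrow>
        (L21_number (mycielski_graph G) = 2 * n + r
          \<longleftrightarrow> \<lceil>real (i4 (complement_graph G)) / 2\<rceil> = int r + 2))"
proof -
  let ?i = "i4 (complement_graph G)" and ?l = "L21_number (mycielski_graph G)"
  have key: "?l \<le> 2 * n + r \<longleftrightarrow> ?i \<le> 2 * r + 4" for r
    using L21_number_mycielski_le_iff[OF assms(1)] assms(2) by blast
  have "?l = 2 * n + r \<longleftrightarrow> \<lceil>real ?i / 2\<rceil> = int r + 2" if r: "r > 0" for r
  proof -
    \<comment> \<open>Equality means that the bound holds for \<open>r\<close> and fails for its
      predecessor \<open>q\<close>, that is, \<open>2 * r + 2 < ?i\<close> and
      \<open>?i \<le> 2 * r + 4\<close>.\<close>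
    obtain q where q: "r = Suc q" using r by (cases r) auto
    have "?l = 2 * n + r \<longleftrightarrow> ?l \<le> 2 * n + r \<and> \<not> ?l \<le> 2 * n + q" unfolding q by linarith
    also have "\<dots> \<longleftrightarrow> ?i \<le> 2 * r + 4 \<and> \<not> ?i \<le> 2 * q + 4" unfolding key ..
    also have "\<dots> \<longleftrightarrow> \<lceil>real ?i / 2\<rceil> = int r + 2" unfolding q ceiling_eq_iff by auto
    finally show ?thesis .
  qed
  then show ?thesis using key[of 0] by simp
qed

end
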